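(* Let $\mathcal{N}$ be a finite ground set, $g\colon 2^{\mathcal{N}}\to\mathbb{R}_{\ge0}$ non-negative, monotone and $\gamma$-weakly submodular for some (unknown) $\gamma\in(0,1]$, $c$ a non-negative modular function, $k\ge1$ an integer, $\mathit{OPT}$ an optimal solution of $\max_{|S|\le k}g(S)-c(S)$, $L\in[0,\gamma]$ a known lower bound, and $\delta\in(0,1)$. Let $\mathcal{A}$ be an algorithm such that for every $\gamma'\in(0,1]$ and every error parameter $\epsilon$, whenever $g$ is $\gamma'$-weakly submodular, $\mathcal{A}(g,\gamma',c,k,\epsilon)$ returns a set $S$ with $|S|\le k$ and $\mathbb{E}[g(S)-c(S)]\ge(1-e^{-\gamma'}-\epsilon)g(\mathit{OPT})-c(\mathit{OPT})$. Then $\gamma$-Sweep (described in the context) makes at most $O(\frac1\delta\log\frac1\delta)$ calls to $\mathcal{A}$ and returns a set $R$ with \[ \mathbb{E}[g(R)-c(R)]\ \ge\ (1-e^{-\gamma}-O(\delta))\,g(\mathit{OPT})-c(\mathit{OPT}). \]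
   Context: Notation: $g(e\mid S)=g(S\cup\{e\})-g(S)$; a monotone $g$ is $\gamma$-weakly submodular if $\sum_{e\in B\setminus A}g(e\mid A)\ge\gamma(g(A\cup B)-g(A))$ for all $A\subseteq B$; $c(S)=\sum_{e\in S}c_e$, $c_e\ge0$. $\gamma$-Sweep (input $g,c,\mathcal{A},L,\delta$): set $S_{-1}=\varnothing$ and $T=\lceil\frac1\delta\ln(1/\max\{\delta,L\})\rceil$. For $r=0,\dots,T$: $\gamma_r=(1-\delta)^r$ and $S_r=\mathcal{A}(g,\gamma_r,c,k,\delta)$. Return the set $R$ maximizing $g(R)-c(R)$ among $S_{-1},S_0,\dots,S_T$. *)

theory Defs
  imports "HOL-Probability.Probability" "HOL-Library.Landau_Symbols"
begin

definition marginal :: "('a set \<Rightarrow> real) \<Rightarrow> 'a \<Rightarrow> 'a set \<Rightarrow> real" where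
  "marginal g e S = g (S \<union> {e}) - g S"

definition weakly_submodular_on :: "'a set \<Rightarrow> real \<Rightarrow> ('a set \<Rightarrow> real) \<Rightarrow> bool" where
  "weakly_submodular_on N \<gamma> g \<longleftrightarrow>
     (\<forall>A B. A \<subseteq> B \<and> B \<subseteq> N \<longrightarrow>
        (\<Sum>e\<in>B - A. marginal g e A) \<ge> \<gamma> * (g (A \<union> B) - g A))"

text \<open>
  A procedure that may call a randomized subroutine is an interaction tree: it either
  stops with a result, or issues a query and continues depending on the answer.
  Running it against a concrete subroutine yields the joint distribution of the result and of
  the number of calls made; every call draws fresh, independent randomness.
\<close>

datatype ('q, 'a, 'r) oracle_prog =
    Return 'r
  | Call 'q "'a \<Rightarrow> ('q, 'a, 'r) oracle_prog"

primrec run :: "('q \<Rightarrow> 'a pmf) \<Rightarrow> ('q, 'a, 'r) oracle_prog \<Rightarrow> ('r \<times> nat) pmf" where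
  "run \<A> (Return x) = return_pmf (x, 0)"
| "run \<A> (Call q f) =
     bind_pmf (\<A> q) (\<lambda>a. map_pmf (\<lambda>(x, m). (x, Suc m)) (run \<A> (f a)))"

primrec call_each :: "'q list \<Rightarrow> ('a list \<Rightarrow> 'r) \<Rightarrow> ('q, 'a, 'r) oracle_prog" where
  "call_each [] h = Return (h [])"
| "call_each (q # qs) h = Call q (\<lambda>a. call_each qs (\<lambda>as. h (a # as)))"

text \<open>
  A query consists of the objective, the assumed weak-submodularity parameter, the element
  costs, the cardinality bound and the error parameter, in this order.
\<close>

type_synonym 'a query = "('a set \<Rightarrow> real) \<times> real \<times> ('a \<Rightarrow> real) \<times> nat \<times> real"

definition sweep_length :: "real \<Rightarrow> real \<Rightarrow> nat" where
  "sweep_length L \<delta> = nat \<lceil>1 / \<delta> * ln (1 / max \<delta> L)\<rceil>"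

text \<open>
  The candidate set always contains the empty set. Ties between maximizers are broken by an
  arbitrary fixed choice, which does not affect the value of the result.
\<close>

definition gamma_sweep ::
  "('a set \<Rightarrow> real) \<Rightarrow> ('a \<Rightarrow> real) \<Rightarrow> nat \<Rightarrow> real \<Rightarrow> real
     \<Rightarrow> ('a query, 'a set, 'a set) oracle_prog" where
  "gamma_sweep g c k L \<delta> =
     call_each (map (\<lambda>r. (g, (1 - \<delta>) ^ r, c, k, \<delta>)) [0..<Suc (sweep_length L \<delta>)])
       (\<lambda>Ss. arg_max_on (\<lambda>S. g S - sum c S) (insert {} (set Ss)))"

end

theory Submission
  imports Defs "HOL-Real_Asymp.Real_Asymp"
begin

text \<open>
  The geometric grid of guesses contains a value \<open>\<gamma>\<^sub>r \<le> \<gamma>\<close> with \<open>\<gamma> - \<gamma>\<^sub>r \<le> \<delta>\<close> as soon as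
  \<open>\<gamma> \<ge> \<delta>\<close>, because \<open>(1 - \<delta>)^T \<le> exp (- \<delta> T) \<le> max \<delta> L \<le> \<gamma>\<close>. Weak submodularity is inherited by
  smaller parameters, so the guarantee of the subroutine applies to this guess, and replacing
  \<open>\<gamma>\<^sub>r\<close> by \<open>\<gamma>\<close> in the bound costs at most \<open>\<delta>\<close>. If \<open>\<gamma> < \<delta>\<close>, the claimed bound is at most \<open>0\<close>,
  and the empty set already achieves it.
\<close>

text \<open>The gain \<open>g (A \<union> B) - g A\<close> is nonnegative by monotonicity, so a
  smaller factor only weakens the required inequality.\<close>

lemma weakly_submodular_on_mono:
  assumes "weakly_submodular_on N \<gamma> g" "mono_on (Pow N) g" "\<gamma>' \<le> \<gamma>"
  shows "weakly_submodular_on N \<gamma>' g"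
  unfolding weakly_submodular_on_def
proof (intro allI impI)
  fix A B assume AB: "A \<subseteq> B \<and> B \<subseteq> N"
  then have "g A \<le> g (A \<union> B)"
    using assms(2) by (auto simp: mono_on_def)
  then have "\<gamma>' * (g (A \<union> B) - g A) \<le> \<gamma> * (g (A \<union> B) - g A)"
    using assms(3) by (intro mult_right_mono) auto
  also have "\<dots> \<le> (\<Sum>e\<in>B - A. marginal g e A)"
    using assms(1) AB by (auto simp: weakly_submodular_on_def)
  finally show "\<gamma>' * (g (A \<union> B) - g A) \<le> (\<Sum>e\<in>B - A. marginal g e A)" .
qed

section \<open>Independent answers to a fixed list of queries\<close>

primrec answers :: "('q \<Rightarrow> 'a pmf) \<Rightarrow> 'q list \<Rightarrow> 'a list pmf" where
  "answers \<A> [] = return_pmf []"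
| "answers \<A> (q # qs) = bind_pmf (\<A> q) (\<lambda>a. map_pmf ((#) a) (answers \<A> qs))"

text \<open>The queries are fixed in advance, so all randomness sits in \<open>answers\<close>: the
  result is a function of the answer list and the call count is deterministic.\<close>

lemma run_call_each:
  "run \<A> (call_each qs h) = map_pmf (\<lambda>as. (h as, length qs)) (answers \<A> qs)"
  by (induction qs arbitrary: h) (simp_all add: map_bind_pmf pmf.map_comp o_def)

text \<open>The marginal law of a single answer: at index \<open>0\<close> the tail integrates out,
  at a later index the head does.\<close>

lemma map_nth_answers:
  "i < length qs \<Longrightarrow> map_pmf (\<lambda>as. as ! i) (answers \<A> qs) = \<A> (qs ! i)"
proof (induction qs arbitrary: i)
  case (Cons q qs)
  show ?case
  proof (cases i)
    case 0
    then show ?thesis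
      by (simp add: map_bind_pmf pmf.map_comp o_def map_pmf_const bind_return_pmf')
  next
    case (Suc j)
    then show ?thesis
      using Cons by (simp add: map_bind_pmf pmf.map_comp o_def bind_pmf_const)
  qed
qed simp

lemma length_answers: "as \<in> set_pmf (answers \<A> qs) \<Longrightarrow> length as = length qs"
  by (induction qs arbitrary: as) auto

lemma set_answers:
  "as \<in> set_pmf (answers \<A> qs) \<Longrightarrow> set as \<subseteq> (\<Union>q\<in>set qs. set_pmf (\<A> q))"
  by (induction qs arbitrary: as) fastforce+

lemma finite_set_answers:
  "(\<And>q. q \<in> set qs \<Longrightarrow> finite (set_pmf (\<A> q))) \<Longrightarrow> finite (set_pmf (answers \<A> qs))"
  by (induction qs) auto

text \<open>Compares the final result with one chosen query: \<open>w (h as)\<close> dominates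
  \<open>v (as ! i)\<close> pointwise, and \<open>as ! i\<close> is distributed as the answer to
  \<open>q\<close>. Finite supports make both sides integrable.\<close>

lemma expectation_call_each_ge:
  fixes v :: "'a \<Rightarrow> real" and w :: "'r \<Rightarrow> real"
  assumes "q \<in> set qs"
    and fin: "\<And>q. q \<in> set qs \<Longrightarrow> finite (set_pmf (\<A> q))"
    and le: "\<And>as a. as \<in> set_pmf (answers \<A> qs) \<Longrightarrow> a \<in> set as \<Longrightarrow> v a \<le> w (h as)"
  shows "measure_pmf.expectation (\<A> q) v
    \<le> measure_pmf.expectation (run \<A> (call_each qs h)) (\<lambda>(R, m). w R)"
proof -
  obtain i where i: "i < length qs" "q = qs ! i"
    using assms(1) by (auto simp: in_set_conv_nth)
  have int: "integrable (measure_pmf (answers \<A> qs)) f" for f :: "'a list \<Rightarrow> real"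
    by (intro integrable_measure_pmf_finite finite_set_answers fin)
  have "measure_pmf.expectation (\<A> q) v
      = measure_pmf.expectation (answers \<A> qs) (\<lambda>as. v (as ! i))"
    unfolding i(2) map_nth_answers[OF i(1), symmetric] by simp
  also have "\<dots> \<le> measure_pmf.expectation (answers \<A> qs) (\<lambda>as. w (h as))"
    using i(1) by (intro integral_mono_AE int)
      (auto simp: AE_measure_pmf_iff intro!: le dest: length_answers)
  also have "\<dots> = measure_pmf.expectation (run \<A> (call_each qs h)) (\<lambda>(R, m). w R)"
    by (simp add: run_call_each)
  finally show ?thesis .
qed

text \<open>\<open>arg_max_on\<close> is a choice operator and says something only once a maximizer
  exists; \<open>Max\<close> of the finite nonempty image supplies one.\<close>

lemma finite_arg_max_on:
  fixes f :: "'a \<Rightarrow> real"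
  assumes "finite S" "S \<noteq> {}"
  shows "arg_max_on f S \<in> S" and "x \<in> S \<Longrightarrow> f x \<le> f (arg_max_on f S)"
proof -
  have "Max (f ` S) \<in> f ` S"
    using assms by simp
  then obtain m where m: "m \<in> S" "Max (f ` S) = f m"
    by auto
  have le: "f y \<le> f m" if "y \<in> S" for y
    using assms that by (simp flip: m(2))
  have "arg_max_on f S \<in> S \<and> (\<forall>x\<in>S. f x \<le> f (arg_max_on f S))"
    unfolding arg_max_on_def by (rule arg_maxI[where x = m]) (use m le in \<open>auto simp: not_less\<close>)
  then show "arg_max_on f S \<in> S" and "x \<in> S \<Longrightarrow> f x \<le> f (arg_max_on f S)"
    by auto
qed

section \<open>Length and fineness of the geometric grid\<close>

lemma sweep_length_le:
  assumes "0 < \<delta>" "\<delta> < 1" "L \<le> 1"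
  shows "real (sweep_length L \<delta>) \<le> 1 / \<delta> * ln (1 / \<delta>) + 1"
proof -
  \<comment> \<open>With a nonnegative argument \<open>nat\<close> does not truncate, so rounding up
    costs at most \<open>1\<close>.\<close>
  have "0 \<le> 1 / \<delta> * ln (1 / max \<delta> L)"
    using assms by (intro mult_nonneg_nonneg ln_ge_zero) (auto simp: field_simps)
  then have "real (sweep_length L \<delta>) \<le> 1 / \<delta> * ln (1 / max \<delta> L) + 1"
    unfolding sweep_length_def by linarith
  also have "\<dots> \<le> 1 / \<delta> * ln (1 / \<delta>) + 1"
    using assms by (intro add_right_mono mult_left_mono ln_mono) (auto simp: field_simps)
  finally show ?thesis .
qed

lemma power_sweep_length_le:
  assumes "0 < \<delta>" "\<delta> < 1"
  shows "(1 - \<delta>) ^ sweep_length L \<delta> \<le> max \<delta> L"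
proof -
  define T where "T = sweep_length L \<delta>"
  have "1 / \<delta> * ln (1 / max \<delta> L) \<le> real T"
    unfolding T_def sweep_length_def by linarith
  then have "ln (1 / max \<delta> L) \<le> \<delta> * real T"
    using assms by (simp add: field_simps)
  moreover have "max \<delta> L > 0"
    using assms by simp
  ultimately have T: "- (\<delta> * real T) \<le> ln (max \<delta> L)"
    by (simp add: ln_div del: max_less_iff_conj less_max_iff_disj)
  have "(1 - \<delta>) ^ T \<le> exp (- \<delta>) ^ T"
    using assms exp_ge_add_one_self[of "- \<delta>"] by (intro power_mono) auto
  also have "\<dots> = exp (- (\<delta> * real T))"
    by (simp add: exp_of_nat_mult[symmetric] mult.commute)
  also have "\<dots> \<le> exp (ln (max \<delta> L))"
    using T by simp
  also have "\<dots> = max \<delta> L"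
    using assms by simp
  finally show ?thesis
    by (simp add: T_def)
qed

lemma sweep_guess:
  assumes "0 < \<delta>" "\<delta> < 1" "\<delta> \<le> \<gamma>" "L \<le> \<gamma>" "\<gamma> \<le> 1"
  obtains r where "r \<le> sweep_length L \<delta>" "(1 - \<delta>) ^ r \<le> \<gamma>" "\<gamma> - \<delta> \<le> (1 - \<delta>) ^ r"
proof -
  have T: "(1 - \<delta>) ^ sweep_length L \<delta> \<le> \<gamma>"
    using power_sweep_length_le[OF assms(1,2), of L] assms by linarith
  \<comment> \<open>The first guess not exceeding \<open>\<gamma>\<close>. Its predecessor, if any,
    is above \<open>\<gamma>\<close>, so this guess is above
    \<open>(1 - \<delta>) * \<gamma>\<close>, which is at least \<open>\<gamma> - \<delta>\<close>
    since \<open>\<gamma> \<le> 1\<close>.\<close>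
  define r where "r = (LEAST r. (1 - \<delta>) ^ r \<le> \<gamma>)"
  have r: "(1 - \<delta>) ^ r \<le> \<gamma>" "r \<le> sweep_length L \<delta>"
    unfolding r_def using T by (rule LeastI, rule Least_le)
  have "\<gamma> - \<delta> \<le> (1 - \<delta>) ^ r"
  proof (cases r)
    case 0
    then show ?thesis using assms by simp
  next
    case (Suc s)
    then have "\<gamma> < (1 - \<delta>) ^ s"
      using not_less_Least[of s "\<lambda>r. (1 - \<delta>) ^ r \<le> \<gamma>"] by (simp add: r_def)
    then have "(1 - \<delta>) * \<gamma> \<le> (1 - \<delta>) ^ r"
      using assms by (simp add: Suc)
    moreover have "\<delta> * \<gamma> \<le> \<delta>"
      using assms by (simp add: mult_left_le)
    ultimately show ?thesis
      by (simp add: algebra_simps)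
  qed
  then show thesis
    using r that by blast
qed

text \<open>The map \<open>exp (- t)\<close> is 1-Lipschitz on nonnegative reals: factor out
  \<open>exp (- x) \<le> 1\<close> and use \<open>1 - exp (- t) \<le> t\<close>. This turns an error
  in the guess into an equal error in the ratio.\<close>

lemma exp_minus_diff_le:
  fixes x y :: real
  assumes "0 \<le> x" "x \<le> y"
  shows "exp (- x) - exp (- y) \<le> y - x"
proof -
  have "exp (- x) - exp (- y) = exp (- x) * (1 - exp (- (y - x)))"
    by (simp add: algebra_simps flip: exp_add)
  also have "\<dots> \<le> 1 * (y - x)"
  proof (intro mult_mono)
    show "1 - exp (- (y - x)) \<le> y - x"
      using exp_ge_add_one_self[of "- (y - x)"] by linarith
  qed (use assms in auto)
  finally show ?thesis by simp
qed

theorem theorem4: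
  "\<exists>(C::real) (calls :: real \<Rightarrow> real).
     C > 0 \<and> calls \<in> O[at_right 0](\<lambda>\<delta>. 1 / \<delta> * ln (1 / \<delta>)) \<and>
     (\<forall>(N :: 'a set) (g :: 'a set \<Rightarrow> real) (c :: 'a \<Rightarrow> real) (k :: nat) (OPT :: 'a set)
        (\<gamma> :: real) (L :: real) (\<delta> :: real) (\<A> :: 'a query \<Rightarrow> 'a set pmf).
        finite N \<longrightarrow>
        (\<forall>S\<subseteq>N. g S \<ge> 0) \<longrightarrow>
        mono_on (Pow N) g \<longrightarrow>
        0 < \<gamma> \<and> \<gamma> \<le> 1 \<longrightarrow>
        weakly_submodular_on N \<gamma> g \<longrightarrow>
        (\<forall>e\<in>N. c e \<ge> 0) \<longrightarrow>
        k \<ge> 1 \<longrightarrow>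
        is_arg_max (\<lambda>S. g S - sum c S) (\<lambda>S. S \<subseteq> N \<and> card S \<le> k) OPT \<longrightarrow>
        0 \<le> L \<and> L \<le> \<gamma> \<longrightarrow>
        0 < \<delta> \<and> \<delta> < 1 \<longrightarrow>
        (\<forall>\<gamma>' \<epsilon>. 0 < \<gamma>' \<and> \<gamma>' \<le> 1 \<and> 0 < \<epsilon> \<and> \<epsilon> < 1 \<longrightarrow>
           (\<forall>S\<in>set_pmf (\<A> (g, \<gamma>', c, k, \<epsilon>)). S \<subseteq> N) \<and>
           (weakly_submodular_on N \<gamma>' g \<longrightarrow>
              (\<forall>S\<in>set_pmf (\<A> (g, \<gamma>', c, k, \<epsilon>)). card S \<le> k) \<and>
              measure_pmf.expectation (\<A> (g, \<gamma>', c, k, \<epsilon>)) (\<lambda>S. g S - sum c S)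
                \<ge> (1 - exp (- \<gamma>') - \<epsilon>) * g OPT - sum c OPT)) \<longrightarrow>
        (\<forall>(R, m)\<in>set_pmf (run \<A> (gamma_sweep g c k L \<delta>)). R \<subseteq> N \<and> real m \<le> calls \<delta>) \<and>
        measure_pmf.expectation (run \<A> (gamma_sweep g c k L \<delta>)) (\<lambda>(R, m). g R - sum c R)
          \<ge> (1 - exp (- \<gamma>) - C * \<delta>) * g OPT - sum c OPT)"
proof -
  \<comment> \<open>The \<open>2\<close> pays for the ceiling and for the guess with index
    \<open>0\<close>; it is absorbed because the main term tends to infinity as \<delta> tends to
    \<open>0\<close> from the right.\<close>
  define calls :: "real \<Rightarrow> real" where "calls = (\<lambda>\<delta>. 1 / \<delta> * ln (1 / \<delta>) + 2)"
  have calls: "calls \<in> O[at_right 0](\<lambda>\<delta>. 1 / \<delta> * ln (1 / \<delta>))"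
    unfolding calls_def by real_asymp
  \<comment> \<open>In \<open>2 * \<delta>\<close>, one \<delta> is the error parameter passed to
    the subroutine, the other the distance from \<gamma> to the nearest usable guess.\<close>
  have sweep:
    "(\<forall>(R, m)\<in>set_pmf (run \<A> (gamma_sweep g c k L \<delta>)). R \<subseteq> N \<and> real m \<le> calls \<delta>) \<and>
     measure_pmf.expectation (run \<A> (gamma_sweep g c k L \<delta>)) (\<lambda>(R, m). g R - sum c R)
       \<ge> (1 - exp (- \<gamma>) - 2 * \<delta>) * g OPT - sum c OPT"
    if fin: "finite N" and nonneg: "\<forall>S\<subseteq>N. g S \<ge> 0" and mono: "mono_on (Pow N) g"
      and \<gamma>: "0 < \<gamma> \<and> \<gamma> \<le> 1" and ws: "weakly_submodular_on N \<gamma> g"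
      and c: "\<forall>e\<in>N. c e \<ge> 0"
      and OPT: "is_arg_max (\<lambda>S. g S - sum c S) (\<lambda>S. S \<subseteq> N \<and> card S \<le> k) OPT"
      and L: "0 \<le> L \<and> L \<le> \<gamma>" and \<delta>: "0 < \<delta> \<and> \<delta> < 1"
      and \<A>: "\<forall>\<gamma>' \<epsilon>. 0 < \<gamma>' \<and> \<gamma>' \<le> 1 \<and> 0 < \<epsilon> \<and> \<epsilon> < 1 \<longrightarrow>
           (\<forall>S\<in>set_pmf (\<A> (g, \<gamma>', c, k, \<epsilon>)). S \<subseteq> N) \<and>
           (weakly_submodular_on N \<gamma>' g \<longrightarrow>
              (\<forall>S\<in>set_pmf (\<A> (g, \<gamma>', c, k, \<epsilon>)). card S \<le> k) \<and>
              measure_pmf.expectation (\<A> (g, \<gamma>', c, k, \<epsilon>)) (\<lambda>S. g S - sum c S)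
                \<ge> (1 - exp (- \<gamma>') - \<epsilon>) * g OPT - sum c OPT)"
    for N :: "'a set" and g c k OPT \<gamma> L \<delta> and \<A> :: "'a query \<Rightarrow> 'a set pmf"
  proof -
    define val where "val = (\<lambda>S. g S - sum c S)"
    define qs where
      "qs = map (\<lambda>r. (g, (1 - \<delta>) ^ r, c, k, \<delta>)) [0..<Suc (sweep_length L \<delta>)]"
    define best where "best = (\<lambda>Ss. arg_max_on val (insert {} (set Ss)))"
    have run: "run \<A> (gamma_sweep g c k L \<delta>) = run \<A> (call_each qs best)"
      by (simp only: gamma_sweep_def qs_def best_def val_def)
    have best: "best Ss \<in> insert {} (set Ss)" "S \<in> insert {} (set Ss) \<Longrightarrow> val S \<le> val (best Ss)"
      for S Ss unfolding best_def by (intro finite_arg_max_on; simp)+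
    \<comment> \<open>This must cover guesses above \<gamma> too, where weak submodularity may fail;
      containment in \<open>N\<close> is assumed of the subroutine for every guess.\<close>
    have sub: "S \<subseteq> N" if q: "q \<in> set qs" and S: "S \<in> set_pmf (\<A> q)" for q S
    proof -
      obtain r where "q = (g, (1 - \<delta>) ^ r, c, k, \<delta>)"
        using q by (auto simp: qs_def simp del: upt_Suc)
      moreover have "0 < (1 - \<delta>) ^ r" "(1 - \<delta>) ^ r \<le> 1"
        using \<delta> by (auto intro: power_le_one)
      ultimately show ?thesis
        using \<A> \<delta> S by blast
    qed
    have finA: "finite (set_pmf (\<A> q))" if "q \<in> set qs" for q
      by (rule finite_subset[of _ "Pow N"]) (use sub[OF that] fin in auto)
    have len: "real (length qs) \<le> calls \<delta>"
      using sweep_length_le[of \<delta> L] \<gamma> L \<delta> by (simp add: qs_def calls_def)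
    have best_sub: "best Ss \<subseteq> N" if "Ss \<in> set_pmf (answers \<A> qs)" for Ss
      using best(1)[of Ss] set_answers[OF that] sub by blast
    have gOPT: "0 \<le> g OPT" and cOPT: "0 \<le> sum c OPT"
      using OPT nonneg c by (auto simp: is_arg_max_def intro!: sum_nonneg)
    have "(1 - exp (- \<gamma>) - 2 * \<delta>) * g OPT - sum c OPT
      \<le> measure_pmf.expectation (run \<A> (call_each qs best)) (\<lambda>(R, m). val R)"
    proof (cases "\<delta> \<le> \<gamma>")
      case True
      then obtain r where r: "r \<le> sweep_length L \<delta>"
          "(1 - \<delta>) ^ r \<le> \<gamma>" "\<gamma> - \<delta> \<le> (1 - \<delta>) ^ r"
        using sweep_guess \<gamma> L \<delta> by metis
      define \<rho> where "\<rho> = (1 - \<delta>) ^ r"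
      have \<rho>: "0 < \<rho>" "\<rho> \<le> \<gamma>" "\<gamma> - \<delta> \<le> \<rho>"
        using r \<delta> by (auto simp: \<rho>_def)
      have "exp (- \<rho>) \<le> exp (- \<gamma>) + \<delta>"
        using exp_minus_diff_le[of \<rho> \<gamma>] \<rho> by linarith
      then have "(1 - exp (- \<gamma>) - 2 * \<delta>) * g OPT \<le> (1 - exp (- \<rho>) - \<delta>) * g OPT"
        using gOPT by (intro mult_right_mono) auto
      moreover have "(1 - exp (- \<rho>) - \<delta>) * g OPT - sum c OPT
          \<le> measure_pmf.expectation (\<A> (g, \<rho>, c, k, \<delta>)) val"
        using \<A> \<rho> \<gamma> \<delta> weakly_submodular_on_mono[OF ws mono, of \<rho>] by (simp add: val_def)
      moreover have "measure_pmf.expectation (\<A> (g, \<rho>, c, k, \<delta>)) val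
          \<le> measure_pmf.expectation (run \<A> (call_each qs best)) (\<lambda>(R, m). val R)"
        using r(1) finA best(2)
        by (intro expectation_call_each_ge) (auto simp: qs_def \<rho>_def simp del: upt_Suc)
      ultimately show ?thesis by linarith
    next
      case False
      \<comment> \<open>Here \<open>1 - exp (- \<gamma>) \<le> \<gamma> < \<delta>\<close>.\<close>
      have "1 - exp (- \<gamma>) - 2 * \<delta> \<le> 0"
        using exp_ge_add_one_self[of "- \<gamma>"] False \<delta> by linarith
      then have "(1 - exp (- \<gamma>) - 2 * \<delta>) * g OPT - sum c OPT \<le> 0"
        using mult_nonpos_nonneg[OF _ gOPT] cOPT by (metis diff_le_0_iff_le order_trans)
      also have "0 \<le> measure_pmf.expectation (run \<A> (call_each qs best)) (\<lambda>(R, m). val R)"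
      proof (rule Bochner_Integration.integral_nonneg_AE, unfold AE_measure_pmf_iff)
        \<comment> \<open>The empty set costs nothing and is always a candidate, so every outcome of
          the run has nonnegative value.\<close>
        have "0 \<le> val {}"
          using nonneg by (simp add: val_def)
        then have "0 \<le> val (best Ss)" for Ss
          using best(2)[of "{}" Ss] by simp
        then show "\<forall>x\<in>set_pmf (run \<A> (call_each qs best)). 0 \<le> (case x of (R, m) \<Rightarrow> val R)"
          by (auto simp: run_call_each)
      qed
      finally show ?thesis .
    qed
    moreover have "\<forall>(R, m)\<in>set_pmf (run \<A> (call_each qs best)). R \<subseteq> N \<and> real m \<le> calls \<delta>"
      using best_sub len by (auto simp: run_call_each)
    ultimately show ?thesis
      unfolding run val_def by blast
  qed
  show ?thesis
  \<comment> \<open>Both witnesses are fixed before the instance, so the constants are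
    uniform.\<close>
  proof (rule exI[of _ 2], rule exI[of _ calls], intro conjI[OF _ conjI] allI impI, goal_cases)
    case 3
    then show ?case by (intro sweep) (auto simp only:)
  qed (simp, rule calls)
qed

end
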